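(* Let $\mathcal{W}$ and $\mathcal{Y}$ be real Hilbert spaces and let $\widehat a:\mathcal{W}\times\mathcal{W}\to\mathbb{R}$ and $\widehat b:\mathcal{W}\times\mathcal{Y}\to\mathbb{R}$ be continuous bilinear forms. Let $(\mathcal{W}_n)_{n\in\mathbb{N}^*}$ and $(\mathcal{Y}_n)_{n\in\mathbb{N}^*}$ be approximating sequences of $\mathcal{W}$ and $\mathcal{Y}$ respectively. For $n\in\mathbb{N}^*$ put $$\mathcal{W}_{0,n}=\{u\in\mathcal{W}_n:\ \widehat b(u,q)=0\ \text{for all }q\in\mathcal{Y}_n\},$$ $\mathcal{W}_{0,n}^\star=\mathcal{W}_{0,n}\setminus\{0\}$, $\mathcal{W}_n^\star=\mathcal{W}_n\setminus\{0\}$, $\mathcal{Y}_n^\star=\mathcal{Y}_n\setminus\{0\}$, and assume $\mathcal{W}_{0,n}^\star\ne\emptyset$ and $\mathcal{Y}_n^\star\neq\emptyset$ for all $n$. Assume that, given any $(f,g)\in\mathcal{W}'\times\mathcal{Y}'$, for each $n\in\mathbb{N}^*$ there is a unique $(w_n,p_n)\in\mathcal{W}_n\times\mathcal{Y}_n$ such that $$\widehat a(w_n,z)+\widehat b(z,p_n)=f(z)\ \text{ for all }z\in\mathcal{W}_n,\qquad\widehat b(w_n,q)=g(q)\ \text{ for all }q\in\mathcal{Y}_n,$$ and that $\sup_{n\in\mathbb{N}^*}(\|w_n\|_{\mathcal{W}}+\|p_n\|_{\mathcal{Y}})<\infty$. Then there exists $\beta>0$ such that for all $n\in\mathbb{N}^*$: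 (i) $\displaystyle\inf_{w\in\mathcal{W}_{0,n}^\star}\sup_{z\in\mathcal{W}_{0,n}^\star}\frac{\widehat a(w,z)}{\|w\|_{\mathcal{W}}\|z\|_{\mathcal{W}}}\ge\beta$; (ii) $\displaystyle\inf_{z\in\mathcal{W}_{0,n}^\star}\sup_{w\in\mathcal{W}_{0,n}^\star}\frac{\widehat a(w,z)}{\|w\|_{\mathcal{W}}\|z\|_{\mathcal{W}}}\ge\beta$; (iii) $\displaystyle\inf_{p\in\mathcal{Y}_n^\star}\sup_{z\in\mathcal{W}_n^\star}\frac{\widehat b(z,p)}{\|z\|_{\mathcal{W}}\|p\|_{\mathcal{Y}}}\ge\beta$.
   Context: $\mathbb{N}^*=\{1,2,\dots\}$. Continuity means there is $M>0$ with $|\widehat a(w,v)|\le M\|w\|_{\mathcal{W}}\|v\|_{\mathcal{W}}$ and $|\widehat b(w,q)|\le M\|w\|_{\mathcal{W}}\|q\|_{\mathcal{Y}}$ for all $w,v\in\mathcal{W}$, $q\in\mathcal{Y}$. $\mathcal{W}',\mathcal{Y}'$ are the continuous dual spaces. An approximating sequence of a separable Banach space $\mathcal{X}$ is a sequence $(\mathcal{X}_n)_{n\in\mathbb{N}^*}$ of finite dimensional subspaces such that $\inf\{\|x-\chi\|:\chi\in\mathcal{X}_n\}\to0$ as $n\to\infty$ for all $x\in\mathcal{X}$ (so $\mathcal{W}$ and $\mathcal{Y}$ are separable). *)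

theory Defs
  imports "HOL-Analysis.Analysis"
begin

text \<open>
  The index set is \<open>{1, 2, \<dots>}\<close>; sequences are functions on \<^typ>\<open>nat\<close> whose value at 0 is never used.
  Separability of the space is not listed separately, as it follows from the existence of such a
  sequence. Finite dimension is expressed by a finite spanning set, since \<^const>\<open>dim\<close> is 0 by
  convention on infinite-dimensional sets.
\<close>
definition approximating_sequence :: "(nat \<Rightarrow> 'x::banach set) \<Rightarrow> bool" where
  "approximating_sequence X \<longleftrightarrow>
     (\<forall>n\<ge>1. subspace (X n) \<and> (\<exists>B. finite B \<and> span B = X n)) \<and>
     (\<forall>x. (\<lambda>n. INF y\<in>X n. norm (x - y)) \<longlonglongrightarrow> 0)"

definition discrete_kernel ::
    "('w \<Rightarrow> 'y \<Rightarrow> real) \<Rightarrow> (nat \<Rightarrow> 'w set) \<Rightarrow> (nat \<Rightarrow> 'y set) \<Rightarrow> nat \<Rightarrow> 'w set" where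
  "discrete_kernel b W Y n = {u \<in> W n. \<forall>q\<in>Y n. b u q = 0}"

definition saddle_point_solution ::
    "('w \<Rightarrow> 'w \<Rightarrow> real) \<Rightarrow> ('w \<Rightarrow> 'y \<Rightarrow> real) \<Rightarrow> 'w set \<Rightarrow> 'y set \<Rightarrow>
     ('w::real_normed_vector \<Rightarrow>\<^sub>L real) \<Rightarrow> ('y::real_normed_vector \<Rightarrow>\<^sub>L real) \<Rightarrow> 'w \<times> 'y \<Rightarrow> bool" where
  "saddle_point_solution a b V Q f g = (\<lambda>(w, p).
     w \<in> V \<and> p \<in> Q \<and>
     (\<forall>z\<in>V. a w z + b z p = blinfun_apply f z) \<and>
     (\<forall>q\<in>Q. b w q = blinfun_apply g q))"

end

theory Submission
  imports Defs
begin

text \<open>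
  The hypothesis bounds the discrete solutions separately for each pair of data \<open>(f, g)\<close>; the
  uniform boundedness principle turns this into one constant for all data, and inf-sup conditions
  are then read off by solving with well-chosen data.

  Data of the form \<open>f = (\<phi> \<bullet> _)\<close> and \<open>g = (\<gamma> \<bullet> _)\<close> suffice. The discrete saddle point problem is
  then a single variational problem \<open>c x y = (\<phi>, \<gamma>) \<bullet> y\<close> on \<open>W n \<times> Y n\<close>, inside the Hilbert space
  \<open>'w \<times> 'y\<close>. Its solution operator \<open>S n\<close> is bounded, because the load matters only
  through its orthogonal projection on a finite-dimensional space, and so there is a \<open>C > 0\<close> with
  \<open>norm (S n \<xi>) \<le> C * norm \<xi>\<close> for all \<open>n\<close> and \<open>\<xi>\<close> (\<open>saddle_point_stability\<close>). All three
  estimates hold with \<open>\<beta> = 1 / C\<close>: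

  \<^item> For \<open>p\<close> in \<open>Y n\<close> let \<open>z\<close> be the first component of \<open>S n (0, p)\<close>. Then \<open>b z p = (norm p)\<^sup>2\<close>
    and \<open>norm z \<le> C * norm p\<close>, which is (iii).

  \<^item> For \<open>z\<close> in the discrete kernel let \<open>T z\<close> be the first component of \<open>S n (z, 0)\<close>. It lies in the
    kernel as well, and testing with \<open>z\<close> removes the multiplier, so that \<open>a (T z) z = (norm z)\<^sup>2\<close>
    with \<open>norm (T z) \<le> C * norm z\<close>, which is (ii).

  \<^item> For (i) the first argument \<open>u\<close> of \<open>a\<close> is prescribed. The identity above shows that the linear
    map \<open>T\<close> is injective on the kernel, hence surjective by finite dimension
    (\<open>injective_endomorphism_surjective\<close>). Thus \<open>u = T \<phi>\<close> for some \<open>\<phi>\<close> in the kernel, and \<open>\<phi>\<close> is a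
    good test vector for \<open>u\<close>, again because \<open>a (T \<phi>) \<phi> = (norm \<phi>)\<^sup>2\<close>.
\<close>

section \<open>Uniform boundedness\<close>

text \<open>
  The space is the countable union of the closed sets on which all \<open>T i\<close> are bounded by a given
  natural number. By Baire's theorem one of them contains a ball, and translating this ball to the
  origin gives the common bound.
\<close>

lemma uniform_boundedness:
  fixes T :: "'i \<Rightarrow> 'a::banach \<Rightarrow> 'b::real_normed_vector"
  assumes lin: "\<And>i. i \<in> I \<Longrightarrow> bounded_linear (T i)"
    and bdd: "\<And>x. bdd_above ((\<lambda>i. norm (T i x)) ` I)"
  obtains C where "C > 0" "\<And>i x. i \<in> I \<Longrightarrow> norm (T i x) \<le> C * norm x"
proof -
  define F where "F K = {x. \<forall>i\<in>I. norm (T i x) \<le> real K}" for K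
  have closed_F: "closed (F K)" for K
  proof -
    have "F K = (\<Inter>i\<in>I. {x. norm (T i x) \<le> real K})"
      by (auto simp: F_def)
    moreover have "closed {x. norm (T i x) \<le> real K}" if "i \<in> I" for i
      by (intro closed_Collect_le continuous_intros linear_continuous_on lin that)
    ultimately show ?thesis
      by auto
  qed
  have "x \<in> (\<Union>K. F K)" for x
  proof -
    obtain M where M: "\<And>i. i \<in> I \<Longrightarrow> norm (T i x) \<le> M"
      using bdd[of x] by (auto simp: bdd_above_def)
    obtain K where "M \<le> real K"
      using real_arch_simple by blast
    with M have "x \<in> F K"
      by (force simp: F_def)
    then show ?thesis
      by blast
  qed
  then have "(\<Union>K. F K) = UNIV"
    by blast
  then have "\<exists>K. interior (F K) \<noteq> {}"
    using Baire_category_alt[of "euclidean :: 'a topology" "range F"] closed_F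
    by (force simp: completely_metrizable_space_euclidean)
  then obtain K x0 where "x0 \<in> interior (F K)"
    by blast
  then obtain r where r: "r > 0" "cball x0 r \<subseteq> F K"
    by (meson mem_interior_cball)
  \<comment> \<open>The summand 1 only makes the constant positive when \<open>K = 0\<close>.\<close>
  have "norm (T i x) \<le> (2 * real K / r + 1) * norm x" if i: "i \<in> I" for i x
  proof (cases "x = 0")
    case True
    then show ?thesis
      using linear_simps(3)[OF lin[OF i]] by simp
  next
    case False
    define u where "u = (r / norm x) *\<^sub>R x"
    \<comment> \<open>Both \<open>x0\<close> and \<open>x0 + u\<close> lie in the ball, so \<open>T i u\<close> is a difference of two vectors of norm at most \<open>K\<close>.\<close>
    have "norm u = r"
      using False r by (simp add: u_def)
    then have "x0 \<in> F K" "x0 + u \<in> F K"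
      using r by (auto simp: dist_norm subset_iff)
    then have "norm (T i x0) \<le> real K" "norm (T i x0 + T i u) \<le> real K"
      using i linear_simps(1)[OF lin[OF i]] by (auto simp: F_def)
    then have "norm (T i u) \<le> 2 * real K"
      using norm_triangle_ineq4[of "T i x0 + T i u" "T i x0"] by simp
    moreover have "norm (T i u) = r / norm x * norm (T i x)"
      using r by (simp add: u_def linear_simps(5)[OF lin[OF i]])
    ultimately have "norm (T i x) \<le> 2 * real K / r * norm x"
      using r False by (simp add: field_simps)
    then show ?thesis
      by (simp add: distrib_right add_increasing2)
  qed
  moreover have "2 * real K / r + 1 > 0"
    using r by (simp add: add_nonneg_pos)
  ultimately show thesis
    using that by blast
qed

section \<open>Galerkin approximation on finite-dimensional subspaces\<close>

text \<open>
  The left-hand side is the inner product of \<open>y\<close> with the orthogonal projection of \<open>x\<close> on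
  \<open>span E\<close>. A zero vector in \<open>E\<close> does no harm, since it contributes a zero term to the sum.
\<close>

lemma orthogonal_expansion_inner:
  fixes E :: "'a::real_inner set"
  assumes "finite E" "pairwise orthogonal E" "y \<in> span E"
  shows "(\<Sum>e\<in>E. (e \<bullet> x) / (e \<bullet> e) * (e \<bullet> y)) = x \<bullet> y"
  using assms(3)
proof (induction rule: span_induct)
  case base
  \<comment> \<open>The coefficients are hidden behind \<open>d\<close> so that the distributive laws leave their quotients intact.\<close>
  have "subspace {y. (\<Sum>e\<in>E. d e * (e \<bullet> y)) = x \<bullet> y}" for d
    by (auto simp: subspace_def inner_add_right distrib_left sum.distrib
        mult.left_commute sum_distrib_left[symmetric])
  then show ?case .
next
  case (step y)
  have "e \<bullet> y = 0" if "e \<in> E - {y}" for e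
    using that step assms(2) by (auto simp: pairwise_def orthogonal_def)
  then show ?case
    using step assms(1) by (simp add: sum.remove[of E y] inner_commute)
qed

text \<open>
  Only the finitely many solutions \<open>S e\<close> for \<open>e\<close> in an orthogonal spanning set of \<open>V\<close> matter: combining
  them with the expansion coefficients of \<open>\<xi>\<close> gives a solution for \<open>\<xi>\<close>, which is \<open>S \<xi>\<close> by uniqueness.
  So \<open>S\<close> is a finite sum of bounded rank-one maps.
\<close>

lemma galerkin_solution_bounded_linear:
  fixes c :: "'a::real_inner \<Rightarrow> 'a \<Rightarrow> real"
  assumes lin: "\<And>y. linear (\<lambda>x. c x y)"
    and fin: "finite B" "span B = V"
    and sol: "\<And>\<xi>. S \<xi> \<in> V \<and> (\<forall>y\<in>V. c (S \<xi>) y = \<xi> \<bullet> y)"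
    and uniq: "\<And>\<xi> x. x \<in> V \<Longrightarrow> (\<And>y. y \<in> V \<Longrightarrow> c x y = \<xi> \<bullet> y) \<Longrightarrow> x = S \<xi>"
  shows "bounded_linear S"
proof -
  obtain E where E: "finite E" "span E = V" "pairwise orthogonal E"
    using basis_orthogonal fin by metis
  have "(\<Sum>e\<in>E. ((e \<bullet> \<xi>) / (e \<bullet> e)) *\<^sub>R S e) = S \<xi>" for \<xi>
  proof (rule uniq)
    show "(\<Sum>e\<in>E. ((e \<bullet> \<xi>) / (e \<bullet> e)) *\<^sub>R S e) \<in> V"
      using sol E(2) by (metis (no_types, lifting) span_scale span_sum)
    show "c (\<Sum>e\<in>E. ((e \<bullet> \<xi>) / (e \<bullet> e)) *\<^sub>R S e) y = \<xi> \<bullet> y" if "y \<in> V" for y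
      using orthogonal_expansion_inner[OF E(1,3), of y \<xi>] sol that E(2)
      by (simp add: linear_sum[OF lin] linear_cmul[OF lin])
  qed
  moreover have "bounded_linear (\<lambda>\<xi>. \<Sum>e\<in>E. ((e \<bullet> \<xi>) / (e \<bullet> e)) *\<^sub>R S e)"
    by (intro bounded_linear_sum bounded_linear_scaleR_const
        bounded_linear_compose[OF bounded_linear_divide] bounded_linear_inner_right)
  ultimately show ?thesis
    by simp
qed

text \<open>
  Each single operator is bounded by the preceding lemma, so the uniform boundedness principle
  applies to the whole family.
\<close>

lemma galerkin_stability:
  fixes c :: "'a::{real_inner,banach} \<Rightarrow> 'a \<Rightarrow> real" and V :: "'i \<Rightarrow> 'a set"
  assumes lin: "\<And>y. linear (\<lambda>x. c x y)"
    and fin: "\<And>i. i \<in> I \<Longrightarrow> \<exists>B. finite B \<and> span B = V i"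
    and sol: "\<And>i \<xi>. i \<in> I \<Longrightarrow> S i \<xi> \<in> V i \<and> (\<forall>y\<in>V i. c (S i \<xi>) y = \<xi> \<bullet> y)"
    and uniq: "\<And>i \<xi> x. i \<in> I \<Longrightarrow> x \<in> V i \<Longrightarrow> (\<And>y. y \<in> V i \<Longrightarrow> c x y = \<xi> \<bullet> y) \<Longrightarrow> x = S i \<xi>"
    and bdd: "\<And>\<xi>. bdd_above ((\<lambda>i. norm (S i \<xi>)) ` I)"
  obtains C where "C > 0" "\<And>i. i \<in> I \<Longrightarrow> bounded_linear (S i)"
    "\<And>i \<xi>. i \<in> I \<Longrightarrow> norm (S i \<xi>) \<le> C * norm \<xi>"
proof -
  have lin_S: "bounded_linear (S i)" if i: "i \<in> I" for i
  proof -
    obtain B where B: "finite B" "span B = V i"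
      using fin[OF i] by blast
    show ?thesis
      by (rule galerkin_solution_bounded_linear[where c = c, OF lin B sol[OF i] uniq[OF i]])
  qed
  then obtain C where "C > 0" "\<And>i \<xi>. i \<in> I \<Longrightarrow> norm (S i \<xi>) \<le> C * norm \<xi>"
    using uniform_boundedness[of I S] bdd by blast
  then show thesis
    using that lin_S by blast
qed

text \<open>
  If \<open>E\<close> is a basis of \<open>V\<close>, then \<open>T ` E\<close> is an independent subset of \<open>V\<close> of the same size. A vector
  of \<open>V\<close> outside its span would enlarge it to an independent set with more elements than \<open>E\<close>.
\<close>

lemma injective_endomorphism_surjective:
  fixes T :: "'a::real_vector \<Rightarrow> 'a"
  assumes lin: "linear T" and V: "subspace V" "V \<subseteq> span B" "finite B"
    and T: "T ` V \<subseteq> V" and inj: "\<And>x. x \<in> V \<Longrightarrow> T x = 0 \<Longrightarrow> x = 0"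
  shows "T ` V = V"
proof -
  obtain E where E: "E \<subseteq> V" "independent E" "V \<subseteq> span E"
    using maximal_independent_subset[of V] by blast
  have span_E: "span E = V"
    using E V(1) by (simp add: span_minimal subset_antisym)
  have fin_E: "finite E"
    using independent_span_bound[OF V(3) E(2)] E(1) V(2) by blast
  have inj_T: "inj_on T (span E)"
    unfolding span_E using linear_inj_on_iff_eq_0[OF lin V(1)] inj by blast
  have ind: "independent (T ` E)"
    using linear_independent_injective_image[OF lin E(2) inj_T] .
  have card_TE: "card (T ` E) = card E"
    by (meson card_image inj_T inj_on_subset span_superset)
  have "w \<in> span (T ` E)" if "w \<in> V" for w
  proof (rule ccontr)
    assume w: "w \<notin> span (T ` E)"
    have "insert w (T ` E) \<subseteq> span E"
      using span_E that T E(1) by blast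
    then have "card (insert w (T ` E)) \<le> card E"
      using independent_span_bound[OF fin_E independent_insertI[OF w ind]] by blast
    moreover have "w \<notin> T ` E"
      using w by (metis span_base)
    ultimately show False
      using fin_E card_TE by simp
  qed
  moreover have "span (T ` E) = T ` V"
    using linear_span_image[OF lin, of E] span_E by simp
  ultimately show ?thesis
    using T by auto
qed

section \<open>Inf-sup constants\<close>

text \<open>
  On the reals \<open>SUP\<close> and \<open>INF\<close> are meaningful only for bounded nonempty sets. The continuity
  bound for \<open>h\<close> makes every inner supremum finite; then one good test vector \<open>y\<close> for each \<open>x\<close> is enough.
\<close>

lemma inf_sup_ge:
  fixes h :: "'a::real_normed_vector \<Rightarrow> 'b::real_normed_vector \<Rightarrow> real"
  assumes "A \<noteq> {}" "0 \<notin> A" "0 \<notin> D"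
    and bound: "\<And>x y. \<bar>h x y\<bar> \<le> K * (norm x * norm y)"
    and wit: "\<And>x. x \<in> A \<Longrightarrow> \<exists>y\<in>D. \<beta> * (norm x * norm y) \<le> h x y"
  shows "\<beta> \<le> (INF x\<in>A. SUP y\<in>D. h x y / (norm x * norm y))"
proof (rule cINF_greatest)
  fix x assume x: "x \<in> A"
  then obtain y where y: "y \<in> D" "\<beta> * (norm x * norm y) \<le> h x y"
    using wit by blast
  have pos: "norm x * norm y' > 0" if "y' \<in> D" for y'
    using that x assms(2,3) by (metis mult_pos_pos zero_less_norm_iff)
  have "bdd_above ((\<lambda>y. h x y / (norm x * norm y)) ` D)"
    using bound[of x] pos by (intro bdd_aboveI2[where M = K]) (simp add: abs_le_iff pos_divide_le_eq)
  moreover have "\<beta> \<le> h x y / (norm x * norm y)"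
    using y pos by (simp add: pos_le_divide_eq)
  ultimately show "\<beta> \<le> (SUP y\<in>D. h x y / (norm x * norm y))"
    using y(1) by (meson cSUP_upper2)
qed fact

section \<open>Saddle point problems\<close>

text \<open>
  Adding the two equations of the saddle point problem gives one equation on the product space, to
  which \<open>galerkin_stability\<close> applies; no information is lost, since the test vectors \<open>(z, 0)\<close> and
  \<open>(0, q)\<close> recover the two equations.
\<close>

lemma saddle_point_stability:
  fixes a :: "'w::{real_inner, banach} \<Rightarrow> 'w \<Rightarrow> real"
    and b :: "'w \<Rightarrow> 'y::{real_inner, banach} \<Rightarrow> real"
    and W :: "'i \<Rightarrow> 'w set" and Y :: "'i \<Rightarrow> 'y set"
  assumes a: "bounded_bilinear a" and b: "bounded_bilinear b"
    and finW: "\<And>i. i \<in> I \<Longrightarrow> \<exists>B. finite B \<and> span B = W i"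
    and finY: "\<And>i. i \<in> I \<Longrightarrow> \<exists>B. finite B \<and> span B = Y i"
    and sol: "\<And>i \<phi> \<gamma>. i \<in> I \<Longrightarrow> saddle_point_solution a b (W i) (Y i)
        (blinfun_inner_right \<phi>) (blinfun_inner_right \<gamma>) (S i (\<phi>, \<gamma>))"
    and uniq: "\<And>i \<phi> \<gamma> x. i \<in> I \<Longrightarrow> saddle_point_solution a b (W i) (Y i)
        (blinfun_inner_right \<phi>) (blinfun_inner_right \<gamma>) x \<Longrightarrow> x = S i (\<phi>, \<gamma>)"
    and bdd: "\<And>\<xi>. bdd_above ((\<lambda>i. norm (S i \<xi>)) ` I)"
  obtains C where "C > 0" "\<And>i. i \<in> I \<Longrightarrow> bounded_linear (S i)"
    "\<And>i \<xi>. i \<in> I \<Longrightarrow> norm (S i \<xi>) \<le> C * norm \<xi>"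
proof -
  interpret a: bounded_bilinear a by fact
  interpret b: bounded_bilinear b by fact
  define c where "c x y = a (fst x) (fst y) + b (fst y) (snd x) + b (fst x) (snd y)"
    for x y :: "'w \<times> 'y"
  have lin: "linear (\<lambda>x. c x y)" for y
    by (rule linearI)
      (simp_all add: c_def a.add_left b.add_left b.add_right a.scaleR_left b.scaleR_left
        b.scaleR_right algebra_simps)
  have fin: "\<exists>B. finite B \<and> span B = W i \<times> Y i" if i: "i \<in> I" for i
  proof -
    obtain B D where BD: "finite B" "span B = W i" "finite D" "span D = Y i"
      using finW[OF i] finY[OF i] by blast
    have "span (B \<times> {0} \<union> {0} \<times> D) = W i \<times> Y i"
      using BD span_0[of B] span_0[of D]
      by (force simp: span_Un span_Times_sing1 span_Times_sing2)
    with BD show ?thesis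
      by (metis finite.emptyI finite.insertI finite_SigmaI finite_UnI)
  qed
  have eq: "saddle_point_solution a b (W i) (Y i) (blinfun_inner_right \<phi>) (blinfun_inner_right \<gamma>) x
      \<longleftrightarrow> x \<in> W i \<times> Y i \<and> (\<forall>y\<in>W i \<times> Y i. c x y = (\<phi>, \<gamma>) \<bullet> y)" (is "?L \<longleftrightarrow> ?R")
    if i: "i \<in> I" for i x \<phi> \<gamma>
  proof
    show ?L if ?R
    proof -
      have *: "c x (z, q) = (\<phi>, \<gamma>) \<bullet> (z, q)" if "z \<in> W i" "q \<in> Y i" for z q
        using \<open>?R\<close> that by blast
      have "0 \<in> W i" "0 \<in> Y i"
        using finW[OF i] finY[OF i] span_0 by metis+
      then show ?thesis
        using \<open>?R\<close> *[of _ 0] *[of 0]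
        by (auto simp: saddle_point_solution_def c_def inner_prod_def a.zero_right b.zero_left
            b.zero_right)
    qed
    show ?R if ?L
      using that by (auto simp: saddle_point_solution_def c_def inner_prod_def)
  qed
  show thesis
  proof (rule galerkin_stability[where c = c and V = "\<lambda>i. W i \<times> Y i" and S = S, OF lin fin _ _ bdd])
    show "S i \<xi> \<in> W i \<times> Y i \<and> (\<forall>y\<in>W i \<times> Y i. c (S i \<xi>) y = \<xi> \<bullet> y)" if "i \<in> I" for i \<xi>
      using sol[OF that, of "fst \<xi>" "snd \<xi>"] unfolding eq[OF that] prod.collapse .
    show "x = S i \<xi>"
      if "i \<in> I" "x \<in> W i \<times> Y i" "\<And>y. y \<in> W i \<times> Y i \<Longrightarrow> c x y = \<xi> \<bullet> y" for i \<xi> x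
      using uniq[OF that(1), of "fst \<xi>" "snd \<xi>" x] that(2,3)
      unfolding eq[OF that(1)] prod.collapse by blast
  qed (assumption | fact that)+
qed

theorem theorem8p3:
  fixes a :: "'w::{real_inner, banach} \<Rightarrow> 'w \<Rightarrow> real"
    and b :: "'w \<Rightarrow> 'y::{real_inner, banach} \<Rightarrow> real"
    and W :: "nat \<Rightarrow> 'w set"
    and Y :: "nat \<Rightarrow> 'y set"
  assumes "bounded_bilinear a"
    and "bounded_bilinear b"
    and "approximating_sequence W"
    and "approximating_sequence Y"
    and "\<forall>n\<ge>1. discrete_kernel b W Y n - {0} \<noteq> {}"
    and "\<forall>n\<ge>1. Y n - {0} \<noteq> {}"
    and "\<forall>(f :: 'w \<Rightarrow>\<^sub>L real) (g :: 'y \<Rightarrow>\<^sub>L real).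
           (\<forall>n\<ge>1. \<exists>!wp. saddle_point_solution a b (W n) (Y n) f g wp) \<and>
           (\<forall>w p. (\<forall>n\<ge>1. saddle_point_solution a b (W n) (Y n) f g (w n, p n)) \<longrightarrow>
              bdd_above ((\<lambda>n. norm (w n) + norm (p n)) ` {1..}))"
  shows "\<exists>\<beta>>0. \<forall>n\<ge>1.
     (INF w\<in>discrete_kernel b W Y n - {0}. SUP z\<in>discrete_kernel b W Y n - {0}.
        a w z / (norm w * norm z)) \<ge> \<beta> \<and>
     (INF z\<in>discrete_kernel b W Y n - {0}. SUP w\<in>discrete_kernel b W Y n - {0}.
        a w z / (norm w * norm z)) \<ge> \<beta> \<and>
     (INF p\<in>Y n - {0}. SUP z\<in>W n - {0}.
        b z p / (norm z * norm p)) \<ge> \<beta>"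
proof -
  interpret a: bounded_bilinear a by fact
  interpret b: bounded_bilinear b by fact
  obtain Ka where "\<And>w z. \<bar>a w z\<bar> \<le> norm w * norm z * Ka"
    using a.bounded by (metis real_norm_def)
  then have Ka: "\<bar>a w z\<bar> \<le> Ka * (norm w * norm z)" "\<bar>a w z\<bar> \<le> Ka * (norm z * norm w)" for w z
    by (metis mult.commute)+
  obtain Kb where "\<And>w q. \<bar>b w q\<bar> \<le> norm w * norm q * Kb"
    using b.bounded by (metis real_norm_def)
  then have Kb: "\<bar>b w q\<bar> \<le> Kb * (norm q * norm w)" for w q
    by (metis mult.commute)
  have finW: "\<exists>B. finite B \<and> span B = W n" and finY: "\<exists>B. finite B \<and> span B = Y n"
    if "n \<in> {1..}" for n
    using assms(3,4) that by (auto simp: approximating_sequence_def)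
  define S where "S n \<xi> = (THE x. saddle_point_solution a b (W n) (Y n)
      (blinfun_inner_right (fst \<xi>)) (blinfun_inner_right (snd \<xi>)) x)" for n \<xi>
  have ex1: "\<exists>!x. saddle_point_solution a b (W n) (Y n) f g x" if "n \<in> {1..}" for f g n
    using assms(7) that by simp
  have sol: "saddle_point_solution a b (W n) (Y n)
      (blinfun_inner_right \<phi>) (blinfun_inner_right \<gamma>) (S n (\<phi>, \<gamma>))" if "n \<in> {1..}" for n \<phi> \<gamma>
    unfolding S_def fst_conv snd_conv by (rule theI'[OF ex1[OF that]])
  have uniq: "x = S n (\<phi>, \<gamma>)" if "n \<in> {1..}" "saddle_point_solution a b (W n) (Y n)
      (blinfun_inner_right \<phi>) (blinfun_inner_right \<gamma>) x" for n \<phi> \<gamma> x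
    using ex1[OF that(1)] sol[OF that(1)] that(2) by blast
  have bdd: "bdd_above ((\<lambda>n. norm (S n \<xi>)) ` {1..})" for \<xi>
  proof -
    have "\<forall>n\<ge>1. saddle_point_solution a b (W n) (Y n) (blinfun_inner_right (fst \<xi>))
        (blinfun_inner_right (snd \<xi>)) (fst (S n \<xi>), snd (S n \<xi>))"
      using sol[of _ "fst \<xi>" "snd \<xi>"] by simp
    then have "bdd_above ((\<lambda>n. norm (fst (S n \<xi>)) + norm (snd (S n \<xi>))) ` {1..})"
      by (rule assms(7)[THEN spec, THEN spec, THEN conjunct2, THEN spec, THEN spec, THEN mp])
    then obtain M where M: "\<And>n. n \<in> {1..} \<Longrightarrow> norm (fst (S n \<xi>)) + norm (snd (S n \<xi>)) \<le> M"
      by (auto simp: bdd_above_def)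
    have "norm (S n \<xi>) \<le> M" if "n \<in> {1..}" for n
      using M[OF that] norm_Pair_le[of "fst (S n \<xi>)" "snd (S n \<xi>)"] by simp
    then show ?thesis
      by (auto simp: bdd_above_def)
  qed
  obtain C where C: "C > 0" and lin_S: "\<And>n. n \<in> {1..} \<Longrightarrow> bounded_linear (S n)"
    and norm_S: "\<And>n \<xi>. n \<in> {1..} \<Longrightarrow> norm (S n \<xi>) \<le> C * norm \<xi>"
    using saddle_point_stability[of a b "{1..}" W Y S, OF assms(1,2) finW finY sol uniq bdd] by blast
  show ?thesis
  proof (intro exI[of _ "1 / C"] conjI allI impI)
    show "1 / C > 0"
      using C by simp
    fix n :: nat assume "n \<ge> 1"
    then have n: "n \<in> {1..}"
      by simp
    define W0 where "W0 = discrete_kernel b W Y n"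
    obtain B where B: "finite B" "span B = W n"
      using finW[OF n] by blast
    have sub: "subspace W0"
      using subspace_span[of B] unfolding B(2) W0_def discrete_kernel_def
      by (auto simp: subspace_def b.add_left b.scaleR_left b.zero_left)
    have fin_W0: "W0 \<subseteq> span B"
      by (auto simp: B W0_def discrete_kernel_def)
    define w where "w \<xi> = fst (S n \<xi>)" for \<xi>
    have w_W: "w \<xi> \<in> W n" for \<xi>
      using sol[OF n, of "fst \<xi>" "snd \<xi>"]
      by (auto simp: saddle_point_solution_def w_def split: prod.splits)
    have w_b: "b (w \<xi>) q = snd \<xi> \<bullet> q" if "q \<in> Y n" for \<xi> q
      using sol[OF n, of "fst \<xi>" "snd \<xi>"] that
      by (auto simp: saddle_point_solution_def w_def split: prod.splits)
    \<comment> \<open>Testing with a kernel element removes the term with the multiplier.\<close>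
    have w_a: "a (w \<xi>) z = fst \<xi> \<bullet> z" if "z \<in> W0" for \<xi> z
      using sol[OF n, of "fst \<xi>" "snd \<xi>"] that
      by (force simp: saddle_point_solution_def w_def W0_def discrete_kernel_def
          split: prod.splits)
    have norm_w: "norm (w \<xi>) \<le> C * norm \<xi>" for \<xi>
      using norm_S[OF n, of \<xi>] norm_fst_le[of "fst (S n \<xi>)" "snd (S n \<xi>)"]
      by (simp add: w_def)
    \<comment> \<open>The solution operator of the problem restricted to the kernel: find \<open>u\<close> with \<open>a u z = \<phi> \<bullet> z\<close>.\<close>
    define T where "T \<phi> = w (\<phi>, 0)" for \<phi>
    have T_W0: "T \<phi> \<in> W0" for \<phi>
      using w_W w_b by (simp add: T_def W0_def discrete_kernel_def)
    have a_T: "a (T \<phi>) z = \<phi> \<bullet> z" if "z \<in> W0" for \<phi> z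
      using w_a[OF that] by (simp add: T_def)
    have norm_T: "norm (T \<phi>) \<le> C * norm \<phi>" for \<phi>
      using norm_w[of "(\<phi>, 0)"] by (simp add: T_def)
    have lin_T: "linear T"
      unfolding T_def w_def
      by (intro bounded_linear.linear bounded_linear_fst_comp
          bounded_linear_compose[OF lin_S[OF n]] bounded_linear_Pair bounded_linear_ident
          bounded_linear_zero)
    have T_inj: "\<phi> = 0" if "\<phi> \<in> W0" "T \<phi> = 0" for \<phi>
      using a_T[OF that(1), of \<phi>] that(2) by (simp add: a.zero_left)
    have T_surj: "T ` W0 = W0"
      using T_W0 T_inj
      by (intro injective_endomorphism_surjective[OF lin_T sub fin_W0 B(1)]) auto
    have ne: "W0 - {0} \<noteq> {}" "Y n - {0} \<noteq> {}"
      using assms(5,6) \<open>n \<ge> 1\<close> by (auto simp: W0_def)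
    \<comment> \<open>Common to the three estimates: a vector of norm at most \<open>C * s\<close> on which the form takes the value
      \<open>s\<^sup>2\<close> yields a quotient of at least \<open>1 / C\<close>. Here \<open>r\<close> and \<open>s\<close> are the norms of the solution and of its load.\<close>
    have square_ge: "1 / C * (r * s) \<le> s\<^sup>2" if "0 \<le> s" "r \<le> C * s" for r s
      using mult_right_mono[OF that(2,1)] C by (simp add: field_simps power2_eq_square)

    show "1 / C \<le> (INF w\<in>discrete_kernel b W Y n - {0}. SUP z\<in>discrete_kernel b W Y n - {0}.
        a w z / (norm w * norm z))"
      unfolding W0_def[symmetric]
    proof (rule inf_sup_ge[where K = Ka, OF ne(1)])
      fix u assume u: "u \<in> W0 - {0}"
      then obtain \<phi> where \<phi>: "\<phi> \<in> W0" "u = T \<phi>"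
        using T_surj by blast
      moreover have "\<phi> \<noteq> 0"
        using u \<phi> linear_0[OF lin_T] by auto
      moreover have "1 / C * (norm u * norm \<phi>) \<le> a u \<phi>"
        using square_ge[OF _ norm_T[of \<phi>]] a_T[OF \<phi>(1)] \<phi>(2) by (simp add: power2_norm_eq_inner)
      ultimately show "\<exists>z\<in>W0 - {0}. 1 / C * (norm u * norm z) \<le> a u z"
        by blast
    qed (auto intro: Ka)

    have "1 / C \<le> (INF z\<in>W0 - {0}. SUP u\<in>W0 - {0}. a u z / (norm z * norm u))"
    proof (rule inf_sup_ge[where K = Ka, OF ne(1)])
      fix z assume z: "z \<in> W0 - {0}"
      then have "a (T z) z = (norm z)\<^sup>2"
        by (simp add: a_T power2_norm_eq_inner)
      moreover from this have "T z \<noteq> 0"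
        using z by (auto simp: a.zero_left)
      ultimately show "\<exists>u\<in>W0 - {0}. 1 / C * (norm z * norm u) \<le> a u z"
        using square_ge[OF _ norm_T[of z]] T_W0
        by (intro bexI[of _ "T z"]) (auto simp: mult.commute)
    qed (auto intro: Ka)
    then show "1 / C \<le> (INF z\<in>discrete_kernel b W Y n - {0}. SUP w\<in>discrete_kernel b W Y n - {0}.
        a w z / (norm w * norm z))"
      by (simp add: W0_def mult.commute)

    have "1 / C \<le> (INF p\<in>Y n - {0}. SUP z\<in>W n - {0}. b z p / (norm p * norm z))"
    proof (rule inf_sup_ge[where K = Kb, OF ne(2)])
      fix p assume p: "p \<in> Y n - {0}"
      define z where "z = w (0, p)"
      have "b z p = (norm p)\<^sup>2"
        using p by (simp add: z_def w_b power2_norm_eq_inner)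
      moreover from this have "z \<noteq> 0"
        using p by (auto simp: b.zero_left)
      moreover have "norm z \<le> C * norm p"
        using norm_w[of "(0, p)"] by (simp add: z_def)
      ultimately show "\<exists>z\<in>W n - {0}. 1 / C * (norm p * norm z) \<le> b z p"
        using square_ge[of "norm p" "norm z"] w_W
        by (intro bexI[of _ z]) (auto simp: mult.commute z_def)
    qed (auto intro: Kb)
    then show "1 / C \<le> (INF p\<in>Y n - {0}. SUP z\<in>W n - {0}. b z p / (norm z * norm p))"
      by (simp add: mult.commute)
  qed
qed

end
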